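(* Let $n\ge 7$ be an integer. Every connected graph $G$ of order $n$ and size at most $2n$ has a foresty minimum vertex cut. Moreover, the bound is best possible: for every integer $n\ge 7$ there exists a connected graph of order $n$ and size $2n+1$ which has no foresty minimum vertex cut.
   Context: All graphs are finite and simple. The order of a graph is its number of vertices and the size is its number of edges. A vertex cut of a connected graph $G$ is a set $S\subset V(G)$ such that $G-S$ is disconnected. If $G$ has connectivity $k$, a vertex cut $S$ is called minimum if $|S|=k$. A vertex cut $S$ is called a foresty vertex cut if the induced subgraph $G[S]$ is a forest (acyclic). *)

theory Defs
  imports Main
begin

definition simple_graph :: "'a set \<Rightarrow> 'a set set \<Rightarrow> bool" where
  "simple_graph V E \<longleftrightarrow> finite V \<and>
     (\<forall>e\<in>E. \<exists>u v. e = {u, v} \<and> u \<noteq> v \<and> u \<in> V \<and> v \<in> V)"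

definition adj_in :: "'a set \<Rightarrow> 'a set set \<Rightarrow> 'a \<Rightarrow> 'a \<Rightarrow> bool" where
  "adj_in W E u v \<longleftrightarrow> u \<in> W \<and> v \<in> W \<and> {u, v} \<in> E"

definition reachable_in :: "'a set \<Rightarrow> 'a set set \<Rightarrow> 'a \<Rightarrow> 'a \<Rightarrow> bool" where
  "reachable_in W E u v \<longleftrightarrow> (adj_in W E)\<^sup>*\<^sup>* u v"

definition connected_graph :: "'a set \<Rightarrow> 'a set set \<Rightarrow> bool" where
  "connected_graph V E \<longleftrightarrow> V \<noteq> {} \<and> (\<forall>u\<in>V. \<forall>v\<in>V. reachable_in V E u v)"

definition vertex_cut :: "'a set \<Rightarrow> 'a set set \<Rightarrow> 'a set \<Rightarrow> bool" where
  "vertex_cut V E S \<longleftrightarrow> S \<subseteq> V \<and>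
     (\<exists>u\<in>V - S. \<exists>v\<in>V - S. \<not> reachable_in (V - S) E u v)"

definition min_vertex_cut :: "'a set \<Rightarrow> 'a set set \<Rightarrow> 'a set \<Rightarrow> bool" where
  "min_vertex_cut V E S \<longleftrightarrow> vertex_cut V E S \<and>
     (\<forall>T. vertex_cut V E T \<longrightarrow> card S \<le> card T)"

definition has_cycle_in :: "'a set \<Rightarrow> 'a set set \<Rightarrow> bool" where
  "has_cycle_in S E \<longleftrightarrow> (\<exists>cs. length cs \<ge> 3 \<and> distinct cs \<and> set cs \<subseteq> S \<and>
     (\<forall>i < length cs. {cs ! i, cs ! ((i + 1) mod length cs)} \<in> E))"

definition induced_forest :: "'a set \<Rightarrow> 'a set set \<Rightarrow> bool" where
  "induced_forest S E \<longleftrightarrow> \<not> has_cycle_in S E"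

definition foresty_min_vertex_cut :: "'a set \<Rightarrow> 'a set set \<Rightarrow> 'a set \<Rightarrow> bool" where
  "foresty_min_vertex_cut V E S \<longleftrightarrow> min_vertex_cut V E S \<and> induced_forest S E"

end

theory Submission
  imports Defs
begin

text \<open>
  If the connectivity is at most 2 every minimum cut is foresty. Suppose it is 3 and every 3-cut is a
  triangle. Splitting the graph along such a triangle into two pieces, each containing the triangle,
  keeps all hypotheses, and the excess \<open>e - 2n\<close> of the graph is the sum of the excesses of the pieces
  plus 3. The unsplittable pieces are \<open>K\<^sub>4\<close>, of excess \<open>-2\<close>, and graphs of minimum degree at least 4, of
  excess at least 0; hence \<open>n \<ge> 7\<close> forces excess at least 1. If there is no cut of size at most 3, the
  graph is 4-regular. Then either some \<open>K\<^sub>4\<close> occurs, and the four neighbours of one of its edges form a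
  foresty cut, or some neighbourhood is a foresty cut, or every neighbourhood is an induced 4-cycle,
  in which case the graph is the octahedron and \<open>n = 6\<close>.

  For sharpness take the square of a cycle on \<open>n - 1\<close> vertices, which is 4-connected and 4-regular, and
  attach a new vertex to a triangle: this triangle is the only cut of size at most 3.
\<close>

section \<open>Separations and degrees\<close>

text \<open>Form of a vertex cut that avoids reachability: each side is a union of components, so
  sides can be enlarged or restricted without handling paths.\<close>

definition separation :: "'a set \<Rightarrow> 'a set set \<Rightarrow> 'a set \<Rightarrow> 'a set \<Rightarrow> 'a set \<Rightarrow> bool" where
  "separation V E S A B \<longleftrightarrow> S \<subseteq> V \<and> A \<noteq> {} \<and> B \<noteq> {} \<and> A \<inter> B = {} \<and> A \<union> B = V - S \<and>
     (\<forall>a\<in>A. \<forall>b\<in>B. {a, b} \<notin> E)"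

definition nbhd :: "'a set \<Rightarrow> 'a set set \<Rightarrow> 'a \<Rightarrow> 'a set" where
  "nbhd V E v = {u \<in> V. {v, u} \<in> E}"

text \<open>The ambient \<open>E\<close> stays fixed and only the vertex set varies, so all pieces
  of a split share one edge set and are told apart by this restriction.\<close>

definition induced_edges :: "'a set \<Rightarrow> 'a set set \<Rightarrow> 'a set set" where
  "induced_edges V E = {e \<in> E. e \<subseteq> V}"

definition is_clique :: "'a set \<Rightarrow> 'a set set \<Rightarrow> bool" where
  "is_clique S E \<longleftrightarrow> (\<forall>x\<in>S. \<forall>y\<in>S. x \<noteq> y \<longrightarrow> {x, y} \<in> E)"

lemma separation_sym: "separation V E S A B \<Longrightarrow> separation V E S B A"
  unfolding separation_def by (metis Int_commute Un_commute insert_commute)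

text \<open>One side is everything reachable from \<open>u\<close> after deleting \<open>S\<close>;
  conversely, a walk avoiding \<open>S\<close> that starts in \<open>A\<close> never leaves
  \<open>A\<close>.\<close>

lemma vertex_cut_iff_separation:
  "vertex_cut V E S \<longleftrightarrow> (\<exists>A B. separation V E S A B)"
proof
  assume "vertex_cut V E S"
  then obtain u v where S: "S \<subseteq> V" and uv: "u \<in> V - S" "v \<in> V - S"
    and n: "\<not> reachable_in (V - S) E u v"
    unfolding vertex_cut_def by blast
  define A where "A = {x \<in> V - S. reachable_in (V - S) E u x}"
  have "{a, b} \<notin> E" if "a \<in> A" "b \<in> V - S - A" for a b
  proof
    assume "{a, b} \<in> E"
    then have "adj_in (V - S) E a b" using that unfolding A_def adj_in_def by auto
    then have "reachable_in (V - S) E u b"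
      using that(1) unfolding A_def reachable_in_def by (auto intro: rtranclp.rtrancl_into_rtrancl)
    then show False using that unfolding A_def by auto
  qed
  moreover have "u \<in> A" using uv unfolding A_def reachable_in_def by auto
  moreover have "v \<in> V - S - A" using uv n unfolding A_def by auto
  ultimately have "separation V E S A (V - S - A)"
    using S unfolding separation_def A_def by auto
  then show "\<exists>A B. separation V E S A B" by blast
next
  assume "\<exists>A B. separation V E S A B"
  then obtain A B where s: "separation V E S A B" by blast
  then obtain a b where ab: "a \<in> A" "b \<in> B" unfolding separation_def by blast
  have "x \<in> A" if "(adj_in (V - S) E)\<^sup>*\<^sup>* a x" for x
    using that
  proof induction
    case base
    show ?case by (rule ab)
  next
    case (step y z)
    then show ?case using s unfolding separation_def adj_in_def by blast
  qed
  then have "\<not> reachable_in (V - S) E a b"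
    using ab s unfolding reachable_in_def separation_def by blast
  then show "vertex_cut V E S"
    using ab s unfolding vertex_cut_def separation_def by blast
qed

text \<open>Source of every explicitly named cut below: \<open>T\<close> catches all edges leaving
  \<open>X\<close>, and some vertex lies outside both.\<close>

lemma boundary_is_vertex_cut:
  assumes "X \<subseteq> V" "X \<noteq> {}" "T \<subseteq> V" "X \<inter> T = {}" "X \<union> T \<noteq> V"
    and "\<And>x. x \<in> X \<Longrightarrow> nbhd V E x \<subseteq> X \<union> T"
  shows "vertex_cut V E T"
proof -
  have "separation V E T X (V - T - X)"
    using assms unfolding separation_def nbhd_def by blast
  then show ?thesis using vertex_cut_iff_separation by blast
qed

lemma card_incident_edges:
  assumes E: "\<forall>e\<in>E. card e = 2" and v: "v \<in> V"
  shows "card {e \<in> induced_edges V E. v \<in> e} = card (nbhd V E v)"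
proof -
  have "{e \<in> induced_edges V E. v \<in> e} = (\<lambda>u. {v, u}) ` nbhd V E v"
  proof
    show "{e \<in> induced_edges V E. v \<in> e} \<subseteq> (\<lambda>u. {v, u}) ` nbhd V E v"
    proof
      fix e assume e: "e \<in> {e \<in> induced_edges V E. v \<in> e}"
      then have "card e = 2" using E unfolding induced_edges_def by auto
      then obtain x y where "e = {x, y}" by (auto simp: card_2_iff)
      with e show "e \<in> (\<lambda>u. {v, u}) ` nbhd V E v"
        unfolding induced_edges_def nbhd_def by (auto simp: insert_commute)
    qed
  qed (use v in \<open>auto simp: induced_edges_def nbhd_def\<close>)
  moreover have "inj_on (\<lambda>u. {v, u}) (nbhd V E v)"
    by (auto simp: inj_on_def doubleton_eq_iff)
  ultimately show ?thesis by (simp add: card_image)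
qed

lemma handshake:
  assumes E: "\<forall>e\<in>E. card e = 2" and V: "finite V"
  shows "(\<Sum>v\<in>V. card (nbhd V E v)) = 2 * card (induced_edges V E)"
proof -
  have fin: "finite (induced_edges V E)"
    unfolding induced_edges_def by (rule finite_subset[of _ "Pow V"]) (use V in auto)
  have "card {v \<in> V. v \<in> e} = 2" if "e \<in> induced_edges V E" for e
  proof -
    have "{v \<in> V. v \<in> e} = e" "card e = 2" using that E unfolding induced_edges_def by auto
    then show ?thesis by simp
  qed
  then have "(\<Sum>v\<in>V. card {e \<in> induced_edges V E. v \<in> e}) = 2 * card (induced_edges V E)"
    using sum_multicount[OF V fin, of "\<lambda>v e. v \<in> e" 2] by auto
  then show ?thesis using card_incident_edges[OF E] by simp
qed

lemma nbhd_irrefl: "\<forall>e\<in>E. card e = 2 \<Longrightarrow> v \<notin> nbhd V E v"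
  unfolding nbhd_def by auto

text \<open>The neighbourhood of a vertex of degree below \<open>k\<close> would be too small a cut;
  \<open>k < card V\<close> guarantees a vertex beyond it.\<close>

lemma min_degree_ge:
  assumes E: "\<forall>e\<in>E. card e = 2" and V: "finite V" "k < card V"
    and cut: "\<And>T. vertex_cut V E T \<Longrightarrow> k \<le> card T" and v: "v \<in> V"
  shows "k \<le> card (nbhd V E v)"
proof (rule ccontr)
  assume n: "\<not> k \<le> card (nbhd V E v)"
  have fin: "finite (nbhd V E v)" using V unfolding nbhd_def by auto
  have "card (insert v (nbhd V E v)) \<le> Suc (card (nbhd V E v))" by (rule card_insert_le_m1) auto
  then have "{v} \<union> nbhd V E v \<noteq> V" using n V by auto
  then have "vertex_cut V E (nbhd V E v)"
    using v nbhd_irrefl[OF E] by (intro boundary_is_vertex_cut[of "{v}"]) (auto simp: nbhd_def)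
  then show False using cut n by blast
qed

lemma card_edges_ge:
  assumes E: "\<forall>e\<in>E. card e = 2" and V: "finite V" "k < card V"
    and cut: "\<And>T. vertex_cut V E T \<Longrightarrow> k \<le> card T"
  shows "k * card V \<le> 2 * card (induced_edges V E)"
proof -
  have "(\<Sum>v\<in>V. k) \<le> (\<Sum>v\<in>V. card (nbhd V E v))"
    using min_degree_ge[OF assms] by (intro sum_mono) auto
  then show ?thesis using handshake[OF E V(1)] by (simp add: mult.commute)
qed

section \<open>Splitting along triangle cuts\<close>

text \<open>A clique cannot meet both sides of a separation, so one side of the cut of the piece
  misses \<open>S\<close>, and \<open>B\<close> can be added to the other. This passes the cut
  hypotheses on to the pieces of a split.\<close>

lemma vertex_cut_of_side:
  assumes sep: "separation V E S A B" and S: "is_clique S E"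
    and T: "vertex_cut (A \<union> S) E T"
  shows "vertex_cut V E T"
proof -
  obtain X0 Y0 where XY0: "separation (A \<union> S) E T X0 Y0"
    using T vertex_cut_iff_separation by blast
  have "S \<inter> X0 = {} \<or> S \<inter> Y0 = {}"
  proof (rule ccontr)
    assume "\<not> (S \<inter> X0 = {} \<or> S \<inter> Y0 = {})"
    then obtain x y where xy: "x \<in> S" "x \<in> X0" "y \<in> S" "y \<in> Y0" by blast
    then have "x \<noteq> y" "{x, y} \<notin> E" using XY0 unfolding separation_def by auto
    then show False using S xy unfolding is_clique_def by blast
  qed
  then have "\<exists>X Y. separation (A \<union> S) E T X Y \<and> S \<inter> Y = {}"
    using XY0 separation_sym[OF XY0] by blast
  then obtain X Y where XY: "separation (A \<union> S) E T X Y" and SY: "S \<inter> Y = {}" by blast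
  have sub: "A \<inter> B = {}" "A \<union> B = V - S" "S \<subseteq> V" "B \<noteq> {}"
    using sep unfolding separation_def by auto
  have subXY: "X \<inter> Y = {}" "X \<union> Y = A \<union> S - T" "T \<subseteq> A \<union> S" "X \<noteq> {}" "Y \<noteq> {}"
    using XY unfolding separation_def by auto
  have YA: "Y \<subseteq> A" using subXY(2) SY by blast
  have "{b, a} \<notin> E" if "a \<in> A" "b \<in> B" for a b
    using separation_sym[OF sep] that unfolding separation_def by blast
  moreover have "{x, y} \<notin> E" if "x \<in> X" "y \<in> Y" for x y
    using XY that unfolding separation_def by blast
  moreover have "(X \<union> B) \<inter> Y = {}" using subXY(1) YA sub(1) by blast
  moreover have "X \<union> B \<union> Y = V - T" using subXY(2,3) sub by blast
  moreover have "T \<subseteq> V" using subXY(3) sub by blast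
  ultimately have "separation V E T (X \<union> B) Y"
    using subXY(4,5) YA unfolding separation_def by blast
  then show ?thesis using vertex_cut_iff_separation by blast
qed

lemma card_induced_edges_triangle:
  assumes E: "\<forall>e\<in>E. card e = 2" and S: "card S = 3" "is_clique S E"
  shows "card (induced_edges S E) = 3"
proof -
  have fS: "finite S" using S by (metis card.infinite zero_neq_numeral)
  have "card (nbhd S E v) = 2" if "v \<in> S" for v
  proof -
    have "nbhd S E v \<subseteq> S - {v}" using nbhd_irrefl[OF E] unfolding nbhd_def by auto
    moreover have "S - {v} \<subseteq> nbhd S E v" using S that unfolding nbhd_def is_clique_def by auto
    ultimately have "nbhd S E v = S - {v}" by (rule equalityI)
    then show ?thesis using that S fS by simp
  qed
  then show ?thesis using handshake[OF E fS] S by simp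
qed

text \<open>Inclusion-exclusion: no edge joins \<open>A\<close> to \<open>B\<close>, so every edge
  lies in one of the pieces, and the edges in both are those inside \<open>S\<close>.\<close>

lemma card_edges_split:
  assumes E: "\<forall>e\<in>E. card e = 2" and V: "finite V"
    and sep: "separation V E S A B"
  shows "card (induced_edges V E) + card (induced_edges S E)
    = card (induced_edges (A \<union> S) E) + card (induced_edges (B \<union> S) E)"
proof -
  have fin: "finite (induced_edges W E)" if "finite W" for W
    unfolding induced_edges_def by (rule finite_subset[of _ "Pow W"]) (use that in auto)
  have sub: "A \<union> B \<union> S = V" "A \<inter> B = {}" "(A \<union> B) \<inter> S = {}"
    using sep unfolding separation_def by auto
  then have fAB: "finite A" "finite B" "finite S" using V by (auto intro: finite_subset)
  have "induced_edges V E \<subseteq> induced_edges (A \<union> S) E \<union> induced_edges (B \<union> S) E"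
  proof
    fix e assume e: "e \<in> induced_edges V E"
    then have "card e = 2" using E unfolding induced_edges_def by auto
    then obtain x y where xy: "e = {x, y}" by (auto simp: card_2_iff)
    have "\<not> (x \<in> A \<and> y \<in> B)" "\<not> (y \<in> A \<and> x \<in> B)"
      using e sep unfolding xy induced_edges_def separation_def by (auto simp: insert_commute)
    then show "e \<in> induced_edges (A \<union> S) E \<union> induced_edges (B \<union> S) E"
      using e sub unfolding xy induced_edges_def by auto
  qed
  then have "induced_edges V E = induced_edges (A \<union> S) E \<union> induced_edges (B \<union> S) E"
    using sub unfolding induced_edges_def by auto
  moreover have "induced_edges S E = induced_edges (A \<union> S) E \<inter> induced_edges (B \<union> S) E"
    using sub unfolding induced_edges_def by auto
  ultimately show ?thesis
    using card_Un_Int[OF fin fin, of "A \<union> S" "B \<union> S"] fAB by simp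
qed

text \<open>Strong induction on the order. The excess is bounded below by -2, -1, 0 from orders 4,
  5, 6 on; these three clauses feed the induction, and the fourth is the bound wanted in the
  end.\<close>

lemma triangle_cut_edge_bounds:
  assumes E: "\<forall>e\<in>E. card e = 2" and "finite V" "4 \<le> card V"
    and "\<And>T. vertex_cut V E T \<Longrightarrow> 3 \<le> card T"
    and "\<And>T. vertex_cut V E T \<Longrightarrow> card T = 3 \<Longrightarrow> is_clique T E"
  shows "2 * card V \<le> card (induced_edges V E) + 2 \<and>
    (5 \<le> card V \<longrightarrow> 2 * card V \<le> card (induced_edges V E) + 1) \<and>
    (6 \<le> card V \<longrightarrow> 2 * card V \<le> card (induced_edges V E)) \<and>
    (7 \<le> card V \<and> (\<exists>S. vertex_cut V E S \<and> card S = 3) \<longrightarrow> 2 * card V + 1 \<le> card (induced_edges V E))"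
  using assms(2-)
proof (induction "card V" arbitrary: V rule: less_induct)
  case less
  note cut3 = less.prems(3) and tri = less.prems(4)
  show ?case
  proof (cases "\<exists>S. vertex_cut V E S \<and> card S = 3")
    case True
    then obtain S A B where S: "vertex_cut V E S" "card S = 3" and sep: "separation V E S A B"
      using vertex_cut_iff_separation by blast
    have cl: "is_clique S E" using tri S by blast
    have sub: "A \<union> B \<union> S = V" "A \<inter> B = {}" "(A \<union> B) \<inter> S = {}" "A \<noteq> {}" "B \<noteq> {}"
      using sep unfolding separation_def by auto
    then have fin: "finite A" "finite B" "finite S"
      using less.prems(1) by (auto intro: finite_subset)
    have cards: "card (A \<union> S) = card A + 3" "card (B \<union> S) = card B + 3" "1 \<le> card A" "1 \<le> card B"
      using fin sub S(2) by (auto simp: card_Un_disjoint Int_Un_distrib2 Suc_le_eq card_gt_0_iff)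
    have "card V = card (A \<union> B) + card S"
      unfolding sub(1)[symmetric] using fin sub by (intro card_Un_disjoint) auto
    then have cV: "card V = card A + card B + 3" using fin sub S by (simp add: card_Un_disjoint)
    have e: "card (induced_edges V E) + 3
      = card (induced_edges (A \<union> S) E) + card (induced_edges (B \<union> S) E)"
      using card_edges_split[OF E less.prems(1) sep] card_induced_edges_triangle[OF E S(2) cl] by simp
    note cA = vertex_cut_of_side[OF sep cl] and cB = vertex_cut_of_side[OF separation_sym[OF sep] cl]
    have A: "2 * card (A \<union> S) \<le> card (induced_edges (A \<union> S) E) + 2 \<and>
      (5 \<le> card (A \<union> S) \<longrightarrow> 2 * card (A \<union> S) \<le> card (induced_edges (A \<union> S) E) + 1) \<and>
      (6 \<le> card (A \<union> S) \<longrightarrow> 2 * card (A \<union> S) \<le> card (induced_edges (A \<union> S) E))"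
      using less.hyps[of "A \<union> S"] cards cV fin cut3[OF cA] tri[OF cA] by auto
    have B: "2 * card (B \<union> S) \<le> card (induced_edges (B \<union> S) E) + 2 \<and>
      (5 \<le> card (B \<union> S) \<longrightarrow> 2 * card (B \<union> S) \<le> card (induced_edges (B \<union> S) E) + 1) \<and>
      (6 \<le> card (B \<union> S) \<longrightarrow> 2 * card (B \<union> S) \<le> card (induced_edges (B \<union> S) E))"
      using less.hyps[of "B \<union> S"] cards cV fin cut3[OF cB] tri[OF cB] by auto
    \<comment> \<open>The excesses of the pieces add up with 3 more. For order at least 7,
      \<open>card A + card B\<close> is at least 4, so the worst cases are -2 + 0 + 3 and -1 - 1 +
      3.\<close>
    show ?thesis using A B e cards cV by linarith
  next
    case False
    show ?thesis
    proof (cases "card V = 4")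
      case True
      \<comment> \<open>Minimum degree 4 is impossible on four vertices; degree 3 already gives the
        six edges of the complete graph.\<close>
      then have "3 * card V \<le> 2 * card (induced_edges V E)"
        using card_edges_ge[OF E less.prems(1) _ cut3] by simp
      then show ?thesis using True by simp
    next
      case n4: False
      have "4 \<le> card T" if "vertex_cut V E T" for T
        proof -
        have "card T \<noteq> 3" using False that by blast
        then show ?thesis using cut3[OF that] by linarith
      qed
      then have "4 * card V \<le> 2 * card (induced_edges V E)"
        using n4 less.prems(2) by (intro card_edges_ge[OF E less.prems(1)]) auto
      \<comment> \<open>Excess at least 0 gives the first three clauses; the fourth is vacuous
        without a cut of size 3.\<close>
      then show ?thesis using False by auto
    qed
  qed
qed

text \<open>Replaces the cyclic list by a vertex set inducing minimum degree at least 2, the only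
  feature of a cycle that later arguments use.\<close>

lemma cycle_vertices:
  assumes "has_cycle_in S E"
  obtains C where "C \<subseteq> S" "finite C" "3 \<le> card C"
    "\<And>x. x \<in> C \<Longrightarrow> \<exists>y\<in>C. \<exists>z\<in>C. y \<noteq> z \<and> y \<noteq> x \<and> z \<noteq> x \<and> {x, y} \<in> E \<and> {x, z} \<in> E"
proof -
  obtain cs where cs: "3 \<le> length cs" "distinct cs" "set cs \<subseteq> S"
    and e: "\<And>i. i < length cs \<Longrightarrow> {cs ! i, cs ! ((i + 1) mod length cs)} \<in> E"
    using assms unfolding has_cycle_in_def by blast
  let ?l = "length cs"
  have "\<exists>y\<in>set cs. \<exists>z\<in>set cs. y \<noteq> z \<and> y \<noteq> x \<and> z \<noteq> x \<and> {x, y} \<in> E \<and> {x, z} \<in> E"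
    if x: "x \<in> set cs" for x
  proof -
    obtain i where i: "i < ?l" "x = cs ! i" using x by (auto simp: in_set_conv_nth)
    \<comment> \<open>\<open>j\<close> and \<open>k\<close> are the cyclic successor and predecessor
      of \<open>i\<close>; they differ because the length is at least 3.\<close>
    define j where "j = (if i + 1 = ?l then 0 else i + 1)"
    define k where "k = (if i = 0 then ?l - 1 else i - 1)"
    have jk: "j < ?l" "k < ?l" "j \<noteq> k" "j \<noteq> i" "k \<noteq> i" "(i + 1) mod ?l = j" "(k + 1) mod ?l = i"
      using i cs(1) by (auto simp: j_def k_def)
    have "{x, cs ! j} \<in> E" using e[OF i(1)] jk i by simp
    moreover have "{x, cs ! k} \<in> E" using e[OF jk(2)] jk i by (simp add: insert_commute)
    moreover have "cs ! j \<noteq> cs ! k" "cs ! j \<noteq> x" "cs ! k \<noteq> x"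
      using jk i cs(2) by (auto simp: nth_eq_iff_index_eq)
    ultimately show ?thesis using jk by (meson nth_mem)
  qed
  with cs show ?thesis by (intro that[of "set cs"]) (auto simp: distinct_card)
qed

lemma card_3_cycle_is_clique:
  assumes "has_cycle_in S E" "card S = 3"
  shows "is_clique S E"
proof -
  obtain C where C: "C \<subseteq> S" "3 \<le> card C"
    and n: "\<And>x. x \<in> C \<Longrightarrow> \<exists>y\<in>C. \<exists>z\<in>C. y \<noteq> z \<and> y \<noteq> x \<and> z \<noteq> x \<and> {x, y} \<in> E \<and> {x, z} \<in> E"
    using cycle_vertices[OF assms(1)] by metis
  have fS: "finite S" using assms(2) by (metis card.infinite zero_neq_numeral)
  then have CS: "C = S" using C assms(2) by (simp add: card_seteq)
  obtain a b c where "S = {a, b, c}" using assms(2) by (auto simp: card_3_iff)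
  then show ?thesis using n unfolding CS is_clique_def by (auto simp: insert_commute)
qed

section \<open>The 4-regular case\<close>

text \<open>By 4-regularity each \<open>p\<close> in \<open>K\<close> has exactly one neighbour
  \<open>f p\<close> outside \<open>K\<close>. The neighbours of an edge of \<open>K\<close> then
  form a cut, in which the two vertices left from \<open>K\<close> are adjacent to nothing but each
  other.\<close>

lemma K4_foresty_cut:
  assumes E: "\<forall>e\<in>E. card e = 2" and V: "finite V" "7 \<le> card V"
    and reg: "\<And>v. v \<in> V \<Longrightarrow> card (nbhd V E v) = 4"
    and cut: "\<And>T. vertex_cut V E T \<Longrightarrow> 4 \<le> card T"
    and K: "K \<subseteq> V" "card K = 4" "is_clique K E"
  shows "\<exists>S. vertex_cut V E S \<and> card S = 4 \<and> \<not> has_cycle_in S E"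
proof -
  have fK: "finite K" using K V by (auto intro: finite_subset)
  have "\<exists>x. nbhd V E p = insert x (K - {p}) \<and> x \<notin> K \<and> x \<in> V" if p: "p \<in> K" for p
  proof -
    have sub: "K - {p} \<subseteq> nbhd V E p" using K p unfolding nbhd_def is_clique_def by auto
    have "card (nbhd V E p - (K - {p})) = 1"
      using card_Diff_subset[OF _ sub] fK p K reg by auto
    then obtain x where x: "nbhd V E p - (K - {p}) = {x}" by (auto simp: card_1_singleton_iff)
    moreover have "x \<noteq> p" using x nbhd_irrefl[OF E] by blast
    ultimately show ?thesis using sub unfolding nbhd_def by (intro exI[of _ x]) blast
  qed
  then obtain f where f: "\<And>p. p \<in> K \<Longrightarrow> nbhd V E p = insert (f p) (K - {p}) \<and> f p \<notin> K \<and> f p \<in> V"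
    by metis
  have T: "vertex_cut V E (insert (f p) (insert (f q) (K - {p, q})))" (is "vertex_cut V E ?T")
    if pq: "p \<in> K" "q \<in> K" "p \<noteq> q" for p q
  proof (rule boundary_is_vertex_cut[of "{p, q}"])
    have "{p, q} \<union> ?T \<subseteq> K \<union> {f p, f q}" using pq by auto
    then have "card ({p, q} \<union> ?T) \<le> card (K \<union> {f p, f q})" using fK by (intro card_mono) auto
    also have "\<dots> \<le> card K + card {f p, f q}" by (rule card_Un_le)
    also have "\<dots> \<le> 6" using K by (auto simp: card_insert_if)
    finally show "{p, q} \<union> ?T \<noteq> V" using V by auto
    show "nbhd V E x \<subseteq> {p, q} \<union> ?T" if "x \<in> {p, q}" for x using that f pq by auto
  qed (use pq f[of p] f[of q] K in auto)
  \<comment> \<open>If two outer neighbours coincided, the cut above would have only three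
    vertices.\<close>
  have inj: "f p \<noteq> f q" if pq: "p \<in> K" "q \<in> K" "p \<noteq> q" for p q
  proof
    assume "f p = f q"
    then have "vertex_cut V E (insert (f p) (K - {p, q}))" using T[OF pq] by simp
    moreover have "card (K - {p, q}) = 2" using pq K fK by (simp add: card_Diff_subset)
    ultimately show False using cut[of "insert (f p) (K - {p, q})"] fK by (simp add: card_insert_if split: if_splits)
  qed
  obtain v K' where "K = insert v K'" "v \<notin> K'" "card K' = 3"
    using K(2) card_eq_SucD[of K 3] by auto
  then obtain a b c where Kabc: "K = {v, a, b, c}" "distinct [v, a, b, c]"
    by (auto simp: card_3_iff)
  let ?S = "{f v, f a, b, c}"
  have "vertex_cut V E ?S"
  proof -
    have "K - {v, a} = {b, c}" using Kabc by auto
    then show ?thesis using T[of v a] Kabc by auto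
  qed
  moreover have "card ?S = 4" using Kabc f[of v] f[of a] inj[of v a] by (auto simp: card_insert_if)
  moreover have "\<not> has_cycle_in ?S E"
  proof
    assume "has_cycle_in ?S E"
    then obtain C where C: "C \<subseteq> ?S" "3 \<le> card C"
      and n: "\<And>x. x \<in> C \<Longrightarrow> \<exists>y\<in>C. \<exists>z\<in>C. y \<noteq> z \<and> y \<noteq> x \<and> z \<noteq> x \<and> {x, y} \<in> E \<and> {x, z} \<in> E"
      using cycle_vertices[of ?S E] by metis
    have SV: "?S \<subseteq> V" using f Kabc K by auto
    \<comment> \<open>A vertex with at most one neighbour in the cut lies on no cycle there; this
      removes \<open>b\<close> and \<open>c\<close> and leaves too few vertices.\<close>
    have sole: "x \<notin> C" if "nbhd V E x \<inter> ?S \<subseteq> {y}" for x y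
    proof
      assume "x \<in> C"
      then obtain y1 z1 where "y1 \<in> C" "z1 \<in> C" "y1 \<noteq> z1" "{x, y1} \<in> E" "{x, z1} \<in> E" using n by blast
      then have "y1 \<in> nbhd V E x \<inter> ?S" "z1 \<in> nbhd V E x \<inter> ?S"
        using C(1) SV unfolding nbhd_def by blast+
      then show False using that \<open>y1 \<noteq> z1\<close> by blast
    qed
    have fn: "f v \<notin> K" "f a \<notin> K" using f[of v] f[of a] Kabc by auto
    have "nbhd V E b \<inter> ?S \<subseteq> {c}"
      using f[of b] fn inj[of v b] inj[of a b] Kabc by auto
    moreover have "nbhd V E c \<inter> ?S \<subseteq> {b}"
      using f[of c] fn inj[of v c] inj[of a c] Kabc by auto
    ultimately have "b \<notin> C" "c \<notin> C" using sole by auto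
    then have "C \<subseteq> {f v, f a}" using C by auto
    then have "card C \<le> card {f v, f a}" by (intro card_mono) auto
    then show False using C(2) by (auto simp: card_insert_if split: if_splits)
  qed
  ultimately show ?thesis by blast
qed

lemma four_regular_foresty_cut:
  assumes E: "\<forall>e\<in>E. card e = 2" and V: "finite V" "7 \<le> card V"
    and reg: "\<And>v. v \<in> V \<Longrightarrow> card (nbhd V E v) = 4"
    and cut: "\<And>T. vertex_cut V E T \<Longrightarrow> 4 \<le> card T"
  shows "\<exists>S. vertex_cut V E S \<and> card S = 4 \<and> \<not> has_cycle_in S E"
proof (rule ccontr)
  assume no: "\<not> ?thesis"
  have noK: "\<not> (K \<subseteq> V \<and> card K = 4 \<and> is_clique K E)" for K
    using K4_foresty_cut[OF assms] no by blast
  have sym: "y \<in> nbhd V E x" if "x \<in> nbhd V E y" "y \<in> V" for x y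
    using that unfolding nbhd_def by (auto simp: insert_commute)
  have irr: "x \<notin> nbhd V E x" for x using nbhd_irrefl[OF E] .
  have inV: "nbhd V E x \<subseteq> V" for x unfolding nbhd_def by auto
  have tri: False if "v \<in> V" "a \<in> nbhd V E v" "b \<in> nbhd V E v" "c \<in> nbhd V E v"
    "b \<in> nbhd V E a" "c \<in> nbhd V E a" "c \<in> nbhd V E b" for v a b c
  proof -
    have "is_clique {v, a, b, c} E" using that
      unfolding is_clique_def nbhd_def by (auto simp: insert_commute)
    moreover have "card {v, a, b, c} = 4" using that irr by (auto simp: card_insert_if)
    moreover have "{v, a, b, c} \<subseteq> V" using that inV by blast
    ultimately show False using noK by blast
  qed
  \<comment> \<open>Inside a neighbourhood every vertex has degree at least 2: the neighbourhood is
    a 4-cut and so carries a cycle, and a cycle on three of its vertices would form a complete graph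
    with \<open>v\<close>. From here the octahedron is rebuilt vertex by vertex.\<close>
  have two: "\<exists>y z. y \<noteq> z \<and> {y, z} \<subseteq> nbhd V E x \<inter> nbhd V E v" if v: "v \<in> V" and x: "x \<in> nbhd V E v" for v x
  proof -
    have fin: "finite (nbhd V E v)" using V inV by (auto intro: finite_subset)
    have "card (insert v (nbhd V E v)) \<le> 5" using reg[OF v] fin by (simp add: card_insert_if)
    then have "{v} \<union> nbhd V E v \<noteq> V" using V by auto
    then have "vertex_cut V E (nbhd V E v)"
      using v irr inV by (intro boundary_is_vertex_cut[of "{v}"]) auto
    then have "has_cycle_in (nbhd V E v) E" using no reg[OF v] by blast
    then obtain C where C: "C \<subseteq> nbhd V E v" "3 \<le> card C" "finite C"
      and n: "\<And>x. x \<in> C \<Longrightarrow> \<exists>y\<in>C. \<exists>z\<in>C. y \<noteq> z \<and> y \<noteq> x \<and> z \<noteq> x \<and> {x, y} \<in> E \<and> {x, z} \<in> E"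
      using cycle_vertices[of "nbhd V E v" E] by metis
    have nC: "\<exists>y\<in>C. \<exists>z\<in>C. y \<noteq> z \<and> y \<noteq> x \<and> z \<noteq> x \<and> y \<in> nbhd V E x \<and> z \<in> nbhd V E x" if "x \<in> C" for x
      using n[OF that] C(1) inV unfolding nbhd_def by blast
    have "card C \<noteq> 3"
    proof
      assume "card C = 3"
      then obtain a b c where Cabc: "C = {a, b, c}" "a \<noteq> b" "a \<noteq> c" "b \<noteq> c" by (auto simp: card_3_iff)
      have "b \<in> nbhd V E a" "c \<in> nbhd V E a" "c \<in> nbhd V E b"
        using nC[of a] nC[of b] Cabc by auto
      then show False using tri[OF v, of a b c] C(1) Cabc by auto
    qed
    moreover have "card C \<le> 4" using card_mono[OF fin C(1)] reg[OF v] by simp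
    ultimately have "C = nbhd V E v" using C fin reg[OF v] by (intro card_seteq) auto
    then show ?thesis using nC[of x] x by blast
  qed
  have four: "nbhd V E x = {p, q, r, s}" if "x \<in> V" "{p, q, r, s} \<subseteq> nbhd V E x" "distinct [p, q, r, s]" for x p q r s
    using that reg V inV by (intro card_seteq[symmetric]) (auto intro: finite_subset)
  obtain v where v: "v \<in> V" using V by fastforce
  obtain a where a: "a \<in> nbhd V E v" using reg[OF v] by fastforce
  obtain b d where bd: "b \<noteq> d" "b \<in> nbhd V E a" "d \<in> nbhd V E a" "b \<in> nbhd V E v" "d \<in> nbhd V E v"
    using two[OF v a] by auto
  have V5: "a \<in> V" "b \<in> V" "d \<in> V" using a bd inV by auto
  have nbd: "d \<notin> nbhd V E b" using tri[OF v a bd(4,5) bd(2,3)] by blast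
  have "card (nbhd V E v - {a, b, d}) = 1"
    using a bd irr reg[OF v] by (subst card_Diff_subset) (auto simp: card_insert_if)
  then obtain c where c: "nbhd V E v - {a, b, d} = {c}" by (auto simp: card_1_singleton_iff)
  have Nv: "nbhd V E v = {a, b, c, d}" and cn: "c \<noteq> a" "c \<noteq> b" "c \<noteq> d" "c \<in> V"
    using a bd c inV by auto
  \<comment> \<open>Of the vertices of \<open>nbhd V E v\<close>, \<open>b\<close> is adjacent to
    neither \<open>d\<close> nor itself, so its two neighbours there are \<open>a\<close> and
    \<open>c\<close>.\<close>
  have bc: "c \<in> nbhd V E b"
    using two[OF v bd(4)] nbd irr[of b] unfolding Nv by auto
  have dc: "c \<in> nbhd V E d"
    using two[OF v bd(5)] nbd irr[of d] sym[of b d] V5 unfolding Nv by auto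
  have nac: "c \<notin> nbhd V E a"
    using tri[OF v a, of b c] bd bc Nv by auto
  have ne: "v \<noteq> a" "v \<noteq> b" "v \<noteq> c" "v \<noteq> d" "a \<noteq> b" "a \<noteq> d" using irr Nv bd by auto
  have va: "v \<in> nbhd V E a" "v \<in> nbhd V E b" "v \<in> nbhd V E c" "v \<in> nbhd V E d"
    using sym v Nv V5 cn by (auto simp: nbhd_def insert_commute)
  have "card (nbhd V E a - {v, b, d}) = 1"
    using va bd ne reg[OF V5(1)] by (subst card_Diff_subset) (auto simp: card_insert_if)
  \<comment> \<open>\<open>x\<close> becomes the vertex opposite \<open>v\<close>. Applying
    \<open>two\<close> around \<open>a\<close> and then around \<open>b\<close> joins it to
    \<open>b\<close>, \<open>d\<close> and \<open>c\<close>.\<close>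
  then obtain x where x: "nbhd V E a - {v, b, d} = {x}" by (auto simp: card_1_singleton_iff)
  have Na: "nbhd V E a = {v, b, d, x}" and xn: "x \<noteq> v" "x \<noteq> b" "x \<noteq> d" "x \<noteq> a" "x \<noteq> c" "x \<in> V"
    using va bd x inV nac irr by auto
  have bx: "x \<in> nbhd V E b" using two[OF V5(1) bd(2)] nbd irr[of b] unfolding Na by auto
  have dx: "x \<in> nbhd V E d"
    using two[OF V5(1) bd(3)] nbd irr[of d] sym[of b d] V5 unfolding Na by auto
  have ab: "a \<in> nbhd V E b" "a \<in> nbhd V E d" using sym bd V5 by auto
  have Nb: "nbhd V E b = {v, a, c, x}" using va ab bc bx ne cn xn V5 by (intro four) auto
  have Nd: "nbhd V E d = {v, a, c, x}" using va ab dc dx ne cn xn V5 by (intro four) auto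
  have nca: "a \<notin> nbhd V E c" using nac sym cn V5 by blast
  have cx: "x \<in> nbhd V E c" using two[OF V5(2) bc] nca irr[of c] unfolding Nb by auto
  have Nc: "nbhd V E c = {v, b, d, x}"
    using va cx sym[OF bc V5(2)] sym[OF dc V5(3)] ne cn xn bd V5 by (intro four) auto
  \<comment> \<open>The other five octahedron vertices have all their neighbours inside the
    octahedron. As a seventh vertex exists, \<open>x\<close> alone would separate them from
    it.\<close>
  have "vertex_cut V E {x}"
  proof (rule boundary_is_vertex_cut[of "{v, a, b, c, d}"])
    have "card ({v, a, b, c, d} \<union> {x}) \<le> 6" by (auto simp: card_insert_if)
    then show "{v, a, b, c, d} \<union> {x} \<noteq> V" using V by auto
    show "{v, a, b, c, d} \<subseteq> V" "{x} \<subseteq> V" using v V5 cn xn by simp_all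
    show "{v, a, b, c, d} \<inter> {x} = {}" using xn by simp
    show "nbhd V E y \<subseteq> {v, a, b, c, d} \<union> {x}" if "y \<in> {v, a, b, c, d}" for y
      using that by (elim insertE) (simp_all add: Nv Na Nb Nc Nd)
  qed simp
  then show False using cut[of "{x}"] by simp
qed

section \<open>Existence of a foresty minimum cut\<close>

lemma foresty_min_cut_exists:
  assumes G: "simple_graph V E" and n: "7 \<le> card V" "card E \<le> 2 * card V"
  shows "\<exists>S. foresty_min_vertex_cut V E S"
proof -
  have V: "finite V" using G unfolding simple_graph_def by blast
  have E: "\<forall>e\<in>E. card e = 2" using G unfolding simple_graph_def by fastforce
  have EV: "induced_edges V E = E" using G unfolding simple_graph_def induced_edges_def by fastforce
  have fT: "finite T" if "vertex_cut V E T" for T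
    using that V unfolding vertex_cut_def by (auto intro: finite_subset)
  show ?thesis
  proof (cases "\<exists>T. vertex_cut V E T \<and> card T \<le> 3")
    case True
    define k where "k = (LEAST k. \<exists>T. vertex_cut V E T \<and> card T = k)"
    have ex: "\<exists>T. vertex_cut V E T \<and> card T = k"
      unfolding k_def by (rule LeastI_ex) (use True in blast)
    have least: "k \<le> card T" if "vertex_cut V E T" for T
      unfolding k_def by (rule Least_le) (use that in blast)
    obtain S where S: "vertex_cut V E S" "card S = k" "\<not> has_cycle_in S E"
    proof (cases "k = 3")
      case k: True
      have "\<exists>S. vertex_cut V E S \<and> card S = 3 \<and> \<not> has_cycle_in S E"
      proof (rule ccontr)
        assume "\<not> ?thesis"
        \<comment> \<open>If no cut of size 3 is foresty, each contains a cycle and is thus a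
          triangle.\<close>
        then have "is_clique T E" if "vertex_cut V E T" "card T = 3" for T
          using card_3_cycle_is_clique that by blast
        then have "2 * card V + 1 \<le> card (induced_edges V E)"
          using triangle_cut_edge_bounds[OF E V] n least ex k by auto
        then show False using n EV by simp
      qed
      then show ?thesis using that k by blast
    next
      case False
      then have k: "k \<le> 2" using True least by fastforce
      obtain S where S: "vertex_cut V E S" "card S = k" using ex by blast
      have "\<not> has_cycle_in S E"
      proof
        assume "has_cycle_in S E"
        then obtain C where "C \<subseteq> S" "3 \<le> card C" using cycle_vertices by metis
        then show False using card_mono[OF fT[OF S(1)], of C] S k by simp
      qed
      then show ?thesis using that S by blast
    qed
    then show ?thesis using least
      unfolding foresty_min_vertex_cut_def min_vertex_cut_def induced_forest_def by blast
  next
    case False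
    \<comment> \<open>Graphs without any vertex cut fall under this case too, where the bound holds
      vacuously.\<close>
    then have cut: "4 \<le> card T" if "vertex_cut V E T" for T using that by force
    have deg: "4 \<le> card (nbhd V E v)" if "v \<in> V" for v
      using min_degree_ge[OF E V _ cut that] n by auto
    have "card (nbhd V E v) = 4" if "v \<in> V" for v
    proof (rule ccontr)
      assume "card (nbhd V E v) \<noteq> 4"
      \<comment> \<open>A single degree above 4 would push the number of edges above
        \<open>2 * card V\<close>.\<close>
      then have "(\<Sum>v\<in>V. 4) < (\<Sum>v\<in>V. card (nbhd V E v))"
        using deg that V by (intro sum_strict_mono_ex1) (auto intro!: bexI[of _ v] simp: le_neq_implies_less)
      then show False using handshake[OF E V] EV n by simp
    qed
    then obtain S where "vertex_cut V E S" "card S = 4" "\<not> has_cycle_in S E"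
      using four_regular_foresty_cut[OF E V n(1) _ cut] by blast
    then show ?thesis using cut
      unfolding foresty_min_vertex_cut_def min_vertex_cut_def induced_forest_def by metis
  qed
qed

section \<open>Sharpness\<close>

text \<open>The square of the cycle on 0, ..., \<open>m - 1\<close>, with the wrap-around edges
  listed separately instead of using \<open>mod\<close>, which eases counting; the cap
  \<open>m\<close> is joined to the triangle 0, 1, 2.\<close>

definition capped_cycle_square :: "nat \<Rightarrow> nat set set" where
  "capped_cycle_square m =
     (\<lambda>i. {i, i + 1}) ` {..<m - 1} \<union> (\<lambda>i. {i, i + 2}) ` {..<m - 2} \<union>
     {{0, m - 1}, {0, m - 2}, {1, m - 1}} \<union> {{0, m}, {1, m}, {2, m}}"

lemma card_capped_cycle_square:
  assumes "6 \<le> m"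
  shows "card (capped_cycle_square m) = 2 * m + 3"
proof -
  let ?A = "(\<lambda>i. {i, i + 1}) ` {..<m - 1}" and ?B = "(\<lambda>i. {i, i + 2}) ` {..<m - 2}"
  let ?C = "{{0, m - 1}, {0, m - 2}, {1, m - 1}}" and ?D = "{{0, m}, {1, m}, {2, m}}"
  have "card ?A = m - 1" by (subst card_image) (auto simp: inj_on_def doubleton_eq_iff)
  moreover have "card ?B = m - 2" by (subst card_image) (auto simp: inj_on_def doubleton_eq_iff)
  moreover have "card ?C = 3" "card ?D = 3"
    using assms by (auto simp: card_insert_if doubleton_eq_iff)
  moreover have "?A \<inter> ?B = {}" by (auto simp: doubleton_eq_iff)
  moreover have "(?A \<union> ?B) \<inter> ?C = {}" 
  proof -
    \<comment> \<open>Steps of length 1 or 2 touching 0 or 1 stay below 4, while a wrap-around edge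
      reaches at least \<open>m - 2\<close>, hence at least 4.\<close>
    have "e \<subseteq> {..3}" if "e \<in> ?A \<union> ?B" "0 \<in> e \<or> 1 \<in> e" for e using that by auto
    moreover have "(0 \<in> e \<or> 1 \<in> e) \<and> \<not> e \<subseteq> {..3}" if "e \<in> ?C" for e using that assms by auto
    ultimately show ?thesis by blast
  qed
  moreover have "(?A \<union> ?B \<union> ?C) \<inter> ?D = {}" 
  proof (rule equals0I)
    fix e assume e: "e \<in> (?A \<union> ?B \<union> ?C) \<inter> ?D"
    have "m \<notin> e" using IntD1[OF e] assms by auto
    moreover have "m \<in> e" using IntD2[OF e] by auto
    ultimately show False by (rule notE)
  qed
  moreover have "finite ?A" "finite ?B" "finite ?C" "finite ?D" by simp_all
  ultimately have "card (?A \<union> ?B \<union> ?C \<union> ?D) = (m - 1) + (m - 2) + 3 + 3"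
    by (simp only: card_Un_disjoint finite_Un simp_thms)
  then show ?thesis unfolding capped_cycle_square_def using assms by simp
qed

lemma simple_capped_cycle_square:
  assumes "6 \<le> m"
  shows "simple_graph {..m} (capped_cycle_square m)"
proof -
  have *: "\<exists>u v. {x, y} = {u, v} \<and> u \<noteq> v \<and> u \<in> {..m} \<and> v \<in> {..m}"
    if "x \<noteq> y" "x \<le> m" "y \<le> m" for x y
    using that by (intro exI[of _ x] exI[of _ y]) auto
  show ?thesis
    unfolding simple_graph_def capped_cycle_square_def using assms
    by (auto simp del: atMost_iff intro!: *)
qed

text \<open>Recovers the rotational form of the edges, so that the cycle can be walked along
  unrolled indices.\<close>

lemma capped_cycle_square_steps:
  assumes "6 \<le> m"
  shows "{j mod m, (j + 1) mod m} \<in> capped_cycle_square m"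
    and "{j mod m, (j + 2) mod m} \<in> capped_cycle_square m"
proof -
  define r where "r = j mod m"
  have r: "r < m" unfolding r_def using assms by simp
  have j1: "(j + 1) mod m = (if r + 1 = m then 0 else r + 1)"
    unfolding r_def by (simp add: mod_Suc)
  have j2: "(j + 2) mod m = (if r + 2 = m then 0 else if r + 1 = m then 1 else r + 2)"
    unfolding r_def using assms by (auto simp: mod_Suc)
  show "{j mod m, (j + 1) mod m} \<in> capped_cycle_square m"
  proof (cases "r + 1 = m")
    case True
    then have "{r, 0} = {0, m - 1}" by auto
    then show ?thesis using True unfolding j1 r_def[symmetric] capped_cycle_square_def by simp
  next
    case False
    then have "r \<in> {..<m - 1}" using r by simp
    then show ?thesis using False unfolding j1 r_def[symmetric] capped_cycle_square_def by simp
  qed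
  consider "r + 1 = m" | "r + 2 = m" | "r \<in> {..<m - 2}" "r + 1 \<noteq> m" "r + 2 \<noteq> m" using r by fastforce
  then show "{j mod m, (j + 2) mod m} \<in> capped_cycle_square m"
  proof cases
    case 1
    then have "{r, 1} = {1, m - 1}" by auto
    then show ?thesis using 1 unfolding j2 r_def[symmetric] capped_cycle_square_def by simp
  next
    case 2
    then have "{r, 0} = {0, m - 2}" by auto
    then show ?thesis using 2 unfolding j2 r_def[symmetric] capped_cycle_square_def by simp
  next
    case 3
    then show ?thesis unfolding j2 r_def[symmetric] capped_cycle_square_def by simp
  qed
qed

text \<open>Beyond the last index before \<open>b\<close> with value in \<open>U\<close>, the next
  two values can only lie in \<open>T\<close>: steps of length 1 and 2 do not leap over a single
  vertex of \<open>T\<close> for free.\<close>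

lemma double_gap:
  fixes f :: "nat \<Rightarrow> 'a"
  assumes "a < b" "f a \<in> U" "f b \<notin> U \<union> T"
    and step: "\<And>j. f j \<in> U \<Longrightarrow> f (j + 1) \<in> U \<union> T \<and> f (j + 2) \<in> U \<union> T"
  shows "\<exists>j. a < j \<and> j + 1 < b \<and> f j \<in> T \<and> f (j + 1) \<in> T"
proof -
  let ?J = "{j. a \<le> j \<and> j < b \<and> f j \<in> U}"
  define i where "i = Max ?J"
  have J: "finite ?J" "?J \<noteq> {}" using assms by auto
  have i: "a \<le> i" "i < b" "f i \<in> U" using Max_in[OF J] unfolding i_def by auto
  have last: "f j \<notin> U" if "i < j" "j \<le> b" for j
  proof
    assume j: "f j \<in> U"
    then have "j \<in> ?J" using that i assms(3) by (cases "j = b") auto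
    then show False using Max_ge[OF J(1) \<open>j \<in> ?J\<close>] that unfolding i_def by linarith
  qed
  have "f (i + 1) \<in> T" using step[OF i(3)] last[of "i + 1"] i by auto
  moreover have "i + 1 < b" using calculation assms(3) i by (cases "i + 1 = b") auto
  moreover have "f (i + 2) \<in> T" using step[OF i(3)] last[of "i + 2"] calculation by auto
  moreover have "i + 2 < b" using calculation assms(3) by (cases "i + 2 = b") auto
  ultimately show ?thesis using i by (intro exI[of _ "i + 1"]) auto
qed

text \<open>Cycle vertices on opposite sides bound two arcs, and by \<open>double_gap\<close> each
  arc contains two consecutive vertices of \<open>T\<close>.\<close>

lemma capped_cycle_square_separation_card:
  assumes m: "6 \<le> m" and sep: "separation {..m} (capped_cycle_square m) T A B"
    and uw: "u \<in> A" "w \<in> B" "u < w" "w < m"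
  shows "4 \<le> card T"
proof -
  let ?f = "\<lambda>j. j mod m"
  have step: "?f (j + 1) \<in> U \<union> T \<and> ?f (j + 2) \<in> U \<union> T"
    if s: "separation {..m} (capped_cycle_square m) T U W" and j: "?f j \<in> U" for U W j
  proof -
    have "?f (j + 1) \<notin> W" "?f (j + 2) \<notin> W"
      using s j capped_cycle_square_steps[OF m, of j] unfolding separation_def by blast+
    moreover have "?f i \<in> {..m}" for i using m by (simp add: less_imp_le)
    ultimately show ?thesis using s unfolding separation_def by blast
  qed
  have T: "T \<subseteq> {..m}" "A \<inter> B = {}" "A \<inter> T = {}" "B \<inter> T = {}"
    using sep unfolding separation_def by auto
  have "\<exists>j. u < j \<and> j + 1 < w \<and> ?f j \<in> T \<and> ?f (j + 1) \<in> T"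
    by (rule double_gap[of u w ?f A T, OF _ _ _ step[OF sep]]) (use uw T in auto)
  then obtain j where j: "u < j" "j + 1 < w" "?f j \<in> T" "?f (j + 1) \<in> T" by blast
  \<comment> \<open>The second arc runs from \<open>w\<close> to \<open>u + m\<close>, which is
    \<open>u\<close> again modulo \<open>m\<close>, with the roles of the sides exchanged.\<close>
  have "\<exists>j. w < j \<and> j + 1 < u + m \<and> ?f j \<in> T \<and> ?f (j + 1) \<in> T"
    by (rule double_gap[of w "u + m" ?f B T, OF _ _ _ step[OF separation_sym[OF sep]]])
      (use uw T in auto)
  then obtain k where k: "w < k" "k + 1 < u + m" "?f k \<in> T" "?f (k + 1) \<in> T" by blast
  \<comment> \<open>All four indices lie strictly within one period, so their residues are
    distinct.\<close>
  have neq: "?f x \<noteq> ?f y" if "u < x" "x < y" "y < u + m" for x y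
  proof
    assume "?f x = ?f y"
    then have "m dvd y - x" using mod_eq_dvd_iff_nat[of x y m] that by simp
    then show False using that dvd_imp_le[of m "y - x"] by simp
  qed
  have "card {?f j, ?f (j + 1), ?f k, ?f (k + 1)} = 4"
    using neq[of j "j + 1"] neq[of j k] neq[of j "k + 1"] neq[of "j + 1" k]
      neq[of "j + 1" "k + 1"] neq[of k "k + 1"] j k uw by (simp add: card_insert_if)
  moreover have "card {?f j, ?f (j + 1), ?f k, ?f (k + 1)} \<le> card T"
    using j k T(1) by (intro card_mono) (auto intro: finite_subset)
  ultimately show ?thesis by simp
qed

text \<open>With at most three cut vertices, the cycle vertices cannot occur on both sides, so one
  side is just the cap and its neighbours 0, 1, 2 all belong to \<open>T\<close>.\<close>

lemma capped_cycle_square_small_cut: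
  assumes m: "6 \<le> m" and cut: "vertex_cut {..m} (capped_cycle_square m) T" "card T \<le> 3"
  shows "T = {0, 1, 2}"
proof -
  obtain A0 B0 where s0: "separation {..m} (capped_cycle_square m) T A0 B0"
    using cut vertex_cut_iff_separation by blast
  have "m \<notin> A0 \<or> m \<notin> B0" using s0 unfolding separation_def by blast
  then have "\<exists>A B. separation {..m} (capped_cycle_square m) T A B \<and> m \<notin> A"
    using s0 separation_sym[OF s0] by blast
  then obtain A B where s: "separation {..m} (capped_cycle_square m) T A B" and mA: "m \<notin> A" by blast
  have sub: "A \<union> B = {..m} - T" "A \<noteq> {}" "B \<noteq> {}" "A \<inter> B = {}" "T \<subseteq> {..m}"
    using s unfolding separation_def by auto
  obtain u where u: "u \<in> A" using sub by blast
  have um: "u < m" using u mA sub by (metis Diff_iff UnI1 atMost_iff le_neq_implies_less)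
  have "w = m" if w: "w \<in> B" for w
  proof (rule ccontr)
    assume "w \<noteq> m"
    moreover have "w \<le> m" using w sub by blast
    ultimately have "w < m" by simp
    moreover have "u \<noteq> w" using u w sub by blast
    ultimately have "4 \<le> card T"
      using capped_cycle_square_separation_card[OF m s u w]
        capped_cycle_square_separation_card[OF m separation_sym[OF s] w u] um by linarith
    then show False using cut(2) by simp
  qed
  then have B: "B = {m}" using sub(3) by blast
  have "x \<in> T" if x: "x \<in> {0, 1, 2}" for x
  proof (rule ccontr)
    assume "x \<notin> T"
    moreover have "x \<le> m" "x \<noteq> m" using x m by auto
    ultimately have "x \<in> A" using sub(1) unfolding B by blast
    moreover have "{x, m} \<in> capped_cycle_square m" using x unfolding capped_cycle_square_def by blast
    ultimately show False using s B unfolding separation_def by blast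
  qed
  then have "{0, 1, 2} \<subseteq> T" by blast
  moreover have "finite T" using sub(5) by (rule finite_subset) simp
  ultimately show ?thesis using cut(2) card_seteq[of T "{0, 1, 2}"] by simp
qed

lemma capped_cycle_square_no_foresty_min_cut:
  assumes m: "6 \<le> m"
  shows "\<not> foresty_min_vertex_cut {..m} (capped_cycle_square m) S"
proof
  assume S: "foresty_min_vertex_cut {..m} (capped_cycle_square m) S"
  have "vertex_cut {..m} (capped_cycle_square m) {0, 1, 2}"
  proof (rule boundary_is_vertex_cut[of "{m}"])
    \<comment> \<open>The vertex 5 is on the cycle because \<open>m\<close> is at least 6, and it
      witnesses a nonempty far side.\<close>
    have "5 \<in> {..m} - ({m} \<union> {0, 1, 2})" using m by auto
    then show "{m} \<union> {0, 1, 2} \<noteq> {..m}" by blast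
    show "nbhd {..m} (capped_cycle_square m) x \<subseteq> {m} \<union> {0, 1, 2}" if "x \<in> {m}" for x
      using that m unfolding nbhd_def capped_cycle_square_def by (auto simp: doubleton_eq_iff)
  qed (use m in auto)
  then have "card S \<le> card {0, 1, 2 :: nat}" "vertex_cut {..m} (capped_cycle_square m) S"
    using S unfolding foresty_min_vertex_cut_def min_vertex_cut_def by blast+
  then have "S = {0, 1, 2}" using capped_cycle_square_small_cut[OF m] by simp
  moreover have "has_cycle_in {0, 1, 2} (capped_cycle_square m)"
  proof -
    have e: "{0, 1} \<in> capped_cycle_square m" "{1, 2} \<in> capped_cycle_square m" "{2, 0} \<in> capped_cycle_square m"
      using capped_cycle_square_steps[OF m, of 0] capped_cycle_square_steps(1)[OF m, of 1] m
      by (auto simp: insert_commute numeral_2_eq_2)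
    have "{[0, 1, 2] ! i, [0, 1, 2] ! ((i + 1) mod 3)} \<in> capped_cycle_square m" if "i < 3" for i
    proof -
      have "i = 0 \<or> i = 1 \<or> i = 2" using that by linarith
      with e show ?thesis by (elim disjE) simp_all
    qed
    then show ?thesis unfolding has_cycle_in_def by (intro exI[of _ "[0, 1, 2]"]) simp
  qed
  ultimately show False using S unfolding foresty_min_vertex_cut_def induced_forest_def by simp
qed

text \<open>Connectedness means that the empty set is no vertex cut, and the only cut of size at
  most 3 is nonempty.\<close>

lemma connected_capped_cycle_square:
  assumes m: "6 \<le> m"
  shows "connected_graph {..m} (capped_cycle_square m)"
proof -
  have "\<not> vertex_cut {..m} (capped_cycle_square m) {}"
    using capped_cycle_square_small_cut[OF m, of "{}"] by auto
  then show ?thesis unfolding connected_graph_def vertex_cut_def by auto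
qed

theorem theorem4:
  fixes n :: nat
  assumes "n \<ge> 7"
  shows "(\<forall>(V :: 'a set) E. simple_graph V E \<and> connected_graph V E \<and> card V = n
            \<and> card E \<le> 2 * n \<longrightarrow> (\<exists>S. foresty_min_vertex_cut V E S))
       \<and> (\<exists>(V :: nat set) E. simple_graph V E \<and> connected_graph V E \<and> card V = n
            \<and> card E = 2 * n + 1 \<and> \<not> (\<exists>S. foresty_min_vertex_cut V E S))"
proof
  show "\<forall>(V :: 'a set) E. simple_graph V E \<and> connected_graph V E \<and> card V = n
      \<and> card E \<le> 2 * n \<longrightarrow> (\<exists>S. foresty_min_vertex_cut V E S)"
    using foresty_min_cut_exists assms by blast
  \<comment> \<open>The cap counts as a vertex, so order \<open>n\<close> corresponds to a cycle of
    length \<open>n - 1\<close>.\<close>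
  have m: "6 \<le> n - 1" using assms by simp
  have "card {..n - 1} = n" "card (capped_cycle_square (n - 1)) = 2 * n + 1"
    using card_capped_cycle_square[OF m] assms by simp_all
  then show "\<exists>(V :: nat set) E. simple_graph V E \<and> connected_graph V E \<and> card V = n
      \<and> card E = 2 * n + 1 \<and> \<not> (\<exists>S. foresty_min_vertex_cut V E S)"
    using simple_capped_cycle_square[OF m] connected_capped_cycle_square[OF m]
      capped_cycle_square_no_foresty_min_cut[OF m] by blast
qed

end
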